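(* Let $n,m\ge3$ be odd integers and let $S$ and $T$ be 2-partitions of $\mathbb{Z}_n^*$ and $\mathbb{Z}_m^*$ respectively, and let $W_{ST}$ be any product of $S$ and $T$. Then $W_{ST}$ is a strong 2-partition of $\mathbb{Z}_{mn}^*$ if and only if $S$ is strong and $T$ is skew.
   Context: $\mathbb{Z}_k^*=\mathbb{Z}_k\setminus\{0\}$; a 2-partition of $\mathbb{Z}_k^*$ ($k$ odd) is a partition into unordered pairs $\{x_i,y_i\}$. It is strong if the sums $x_i+y_i\bmod k$ are all nonzero and pairwise distinct; skew if $\{\pm(x_i+y_i)\bmod k\}=\mathbb{Z}_k^*$. Product: let $n=2q+1$, $m=2p+1$. Let $\tilde S$ be any set of ordered pairs obtained by ordering each pair of $S$ in either way. Let $\bar T=\{(r_j,t_j)\}_{j=1}^p$ be obtained by ordering each pair of $T$ so that $\bigcup_j\{\pm r_j\}=\mathbb{Z}_m^*$, and $\bar T'=\{(-r_j,-t_j)\}_{j=1}^p$. A product $W_{ST}$ is the collection of unordered pairs $\{nr+x,\ nt+y\}$ (mod $nm$, with $x,y$ represented in $\{0,\dots,n-1\}$) of two types: (i) one pair for each $(r,t)\in\bar T\cup\bar T'\cup\{(0,0)\}$ and each $(x,y)\in\tilde S$; (ii) one pair for each $(r,t)\in\bar T$ with $x=y=0$. *)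

theory Defs
  imports Main "HOL-Library.Disjoint_Sets"
begin

text \<open>
  The ring of integers modulo \<open>k\<close> is represented by the least nonnegative residues
  \<open>{0..<k}\<close>, with arithmetic on \<^typ>\<open>int\<close> followed by reduction modulo \<open>k\<close>.
\<close>

definition Zstar :: "int \<Rightarrow> int set" where
  "Zstar k = {0..<k} - {0}"

text \<open>
  An unordered pair is a set of cardinality 2, so that \<open>\<Sum>B\<close> is the sum of the two
  elements of the pair \<open>B\<close>.
\<close>

definition two_partition :: "int \<Rightarrow> int set set \<Rightarrow> bool" where
  "two_partition k P \<longleftrightarrow> partition_on (Zstar k) P \<and> (\<forall>B\<in>P. card B = 2)"

definition strong :: "int \<Rightarrow> int set set \<Rightarrow> bool" where
  "strong k P \<longleftrightarrow> (\<forall>B\<in>P. \<Sum>B mod k \<noteq> 0) \<and> inj_on (\<lambda>B. \<Sum>B mod k) P"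

definition skew :: "int \<Rightarrow> int set set \<Rightarrow> bool" where
  "skew k P \<longleftrightarrow> (\<Union>B\<in>P. {\<Sum>B mod k, (- \<Sum>B) mod k}) = Zstar k"

text \<open>\<open>Q\<close> contains, for each pair of \<open>P\<close>, exactly one of its two orderings.\<close>

definition ordering_of :: "int set set \<Rightarrow> (int \<times> int) set \<Rightarrow> bool" where
  "ordering_of P Q \<longleftrightarrow> bij_betw (\<lambda>(x, y). {x, y}) Q P"

definition neg_pairs :: "int \<Rightarrow> (int \<times> int) set \<Rightarrow> (int \<times> int) set" where
  "neg_pairs m Q = (\<lambda>(r, t). ((- r) mod m, (- t) mod m)) ` Q"

definition product_pairs ::
    "int \<Rightarrow> int \<Rightarrow> (int \<times> int) set \<Rightarrow> (int \<times> int) set \<Rightarrow> int set set" where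
  "product_pairs n m S' T' =
     {{(n * r + x) mod (n * m), (n * t + y) mod (n * m)} | r t x y.
        (r, t) \<in> T' \<union> neg_pairs m T' \<union> {(0, 0)} \<and> (x, y) \<in> S'} \<union>
     {{(n * r) mod (n * m), (n * t) mod (n * m)} | r t. (r, t) \<in> T'}"

text \<open>
  A pair of 2-partitions has many products, one for each choice of orderings; hence
  a predicate on \<open>W\<close> rather than a function of \<open>S\<close> and \<open>T\<close>.
\<close>

definition is_product ::
    "int \<Rightarrow> int \<Rightarrow> int set set \<Rightarrow> int set set \<Rightarrow> int set set \<Rightarrow> bool" where
  "is_product n m S T W \<longleftrightarrow>
     (\<exists>S' T'. ordering_of S S' \<and> ordering_of T T' \<and>
        (\<Union>(r, t)\<in>T'. {r mod m, (- r) mod m}) = Zstar m \<and>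
        W = product_pairs n m S' T')"

end

theory Submission
  imports Defs
begin

text \<open>
  Every element of \<open>{0..<n * m}\<close> is uniquely \<open>n * r + x\<close> with \<open>r \<in> {0..<m}\<close> and
  \<open>x \<in> {0..<n}\<close>. Write \<open>U\<close> for the ordered pairs of \<open>T\<close>, their negatives and \<open>(0, 0)\<close>. Both coordinates
  map \<open>U\<close> onto \<open>{0..<m}\<close>, so the pairs of the product cover \<open>Zstar (n * m)\<close>; since there are only
  half as many pairs as elements, the product is always a 2-partition. Modulo \<open>n\<close>, the sum of a
  pair of the product is the sum \<open>x + y\<close> of a pair of \<open>S\<close>, or 0. If \<open>T\<close> is skew, then the sums
  \<open>r + t\<close> over \<open>U\<close> take each value modulo \<open>m\<close> exactly once, and the sums of the product are
  distinct once those of \<open>S\<close> are. Conversely, the pairs of the product over a single pair of \<open>S\<close> force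
  \<open>T\<close> to be skew; their sums then fill a whole residue class modulo \<open>n\<close>, so no class is used
  twice and the class of 0 is not used.
\<close>

section \<open>Nonzero residues, and residues modulo a product\<close>

lemma finite_Zstar [simp]: "finite (Zstar k)"
  by (simp add: Zstar_def)

lemma card_Zstar: "k > 0 \<Longrightarrow> int (card (Zstar k)) = k - 1"
  by (simp add: Zstar_def of_nat_diff)

lemma uminus_mod_Zstar: "z \<in> Zstar k \<Longrightarrow> (- z) mod k \<in> Zstar k"
  by (auto simp: Zstar_def zmod_zminus1_eq_if)

lemma uminus_uminus_mod_Zstar: "z \<in> Zstar k \<Longrightarrow> (- ((- z) mod k)) mod k = z"
  by (simp only: mod_minus_eq minus_minus) (simp add: Zstar_def)

text \<open>The factor \<open>n\<close> cancels from the difference. This compares two sums with the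
  same residue part \<open>c\<close>, for which only the quotient parts matter.\<close>

lemma mod_mult_left_eq_iff:
  fixes n m :: int
  assumes "n > 0"
  shows "(n * a + c) mod (n * m) = (n * b + c) mod (n * m) \<longleftrightarrow> a mod m = b mod m"
proof -
  have "n * a + c - (n * b + c) = n * (a - b)" by (simp add: algebra_simps)
  with assms show ?thesis by (simp add: mod_eq_dvd_iff)
qed

lemma mod_mult_left_imp_mod_eq:
  fixes n m :: int
  assumes "(n * a + c) mod (n * m) = (n * b + d) mod (n * m)"
  shows "c mod n = d mod n"
proof -
  have "(n * a + c) mod (n * m) mod n = (n * b + d) mod (n * m) mod n"
    using assms by simp
  then show ?thesis by (simp add: mod_mod_cancel)
qed

section \<open>Indexed families of pairs and orderings of 2-partitions\<close>

lemma pairs_two_partition: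
  assumes "finite Q" and cover: "a ` Q \<union> b ` Q = Zstar k"
    and card: "card (Zstar k) = 2 * card Q"
  shows "two_partition k ((\<lambda>q. {a q, b q}) ` Q)"
    and "inj_on (\<lambda>q. {a q, b q}) Q"
    and "\<And>q. q \<in> Q \<Longrightarrow> a q \<noteq> b q"
proof -
  \<comment> \<open>\<open>h\<close> lists the entries of all pairs, the Boolean choosing the
    coordinate. It maps a set of size \<open>2 * card Q\<close> onto a set of the same size, so it
    is injective: no entry occurs twice, and all three claims follow.\<close>
  define h where "h = (\<lambda>(q, f). if f then a q else b q)"
  have "Q \<times> UNIV = (\<lambda>q. (q, True)) ` Q \<union> (\<lambda>q. (q, False)) ` Q"
    by (auto simp: UNIV_bool)
  then have "h ` (Q \<times> UNIV) = Zstar k"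
    by (simp add: image_Un image_image h_def cover)
  moreover have "card (Q \<times> (UNIV :: bool set)) = 2 * card Q"
    by (simp add: card_cartesian_product)
  ultimately have inj: "inj_on h (Q \<times> UNIV)"
    using assms(1) card by (intro eq_card_imp_inj_on) auto
  have aa: "a p = a q \<Longrightarrow> p = q" and bb: "b p = b q \<Longrightarrow> p = q" and ab: "a p \<noteq> b q"
    if "p \<in> Q" "q \<in> Q" for p q
    using that inj_onD[OF inj, of "(p, True)" "(q, True)"]
      inj_onD[OF inj, of "(p, False)" "(q, False)"]
      inj_onD[OF inj, of "(p, True)" "(q, False)"]
    by (auto simp: h_def)
  show ne: "\<And>q. q \<in> Q \<Longrightarrow> a q \<noteq> b q" using ab by blast
  show "inj_on (\<lambda>q. {a q, b q}) Q"
    using aa ab by (auto simp: inj_on_def doubleton_eq_iff)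
  have "disjoint_family_on (\<lambda>q. {a q, b q}) Q"
    using aa bb ab unfolding disjoint_family_on_def by fastforce
  then have "disjoint ((\<lambda>q. {a q, b q}) ` Q)"
    by (rule disjoint_family_on_disjoint_image)
  moreover have "(\<Union>q\<in>Q. {a q, b q}) = Zstar k"
    unfolding cover[symmetric] by auto
  ultimately have "partition_on (Zstar k) ((\<lambda>q. {a q, b q}) ` Q)"
    by (simp add: partition_on_def image_iff)
  then show "two_partition k ((\<lambda>q. {a q, b q}) ` Q)"
    using ne by (auto simp: two_partition_def)
qed

lemma ordering_image: "ordering_of P Q \<Longrightarrow> (\<lambda>q. {fst q, snd q}) ` Q = P"
  by (simp add: ordering_of_def bij_betw_def case_prod_unfold)

lemma ordering_cover:
  assumes "two_partition k P" and "ordering_of P Q"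
  shows "fst ` Q \<union> snd ` Q = Zstar k"
proof -
  have "\<Union> P = Zstar k"
    using assms(1) by (simp add: two_partition_def partition_on_def)
  then show ?thesis unfolding ordering_image[OF assms(2), symmetric] by auto
qed

lemma ordering_finite:
  assumes "two_partition k P" and "ordering_of P Q"
  shows "finite Q"
proof -
  have "Q \<subseteq> Zstar k \<times> Zstar k"
    using ordering_cover[OF assms] by (auto simp: image_iff) force+
  then show ?thesis by (rule finite_subset) simp
qed

lemma ordering_card:
  assumes "two_partition k P" and "ordering_of P Q"
  shows "card (Zstar k) = 2 * card Q"
proof -
  have part: "partition_on (Zstar k) P" and two: "\<forall>B\<in>P. card B = 2"
    using assms(1) by (auto simp: two_partition_def)
  have "card (Zstar k) = sum card P"
    using part two card_Union_disjoint[of P]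
    by (metis partition_on_def finite_Zstar finite_subset Sup_upper)
  also have "\<dots> = 2 * card P" using two by simp
  also have "card P = card Q"
    using assms(2) bij_betw_same_card unfolding ordering_of_def by metis
  finally show ?thesis .
qed

text \<open>Moves strength from sets of size 2 to their indices. Injectivity of the indexing
  transfers distinctness of sums, and \<open>a q \<noteq> b q\<close> ensures that the sum over the
  set is \<open>a q + b q\<close> and not a single entry.\<close>

lemma strong_pairs_iff:
  assumes "inj_on (\<lambda>q. {a q, b q}) Q" and "\<And>q. q \<in> Q \<Longrightarrow> a q \<noteq> b q"
  shows "strong k ((\<lambda>q. {a q, b q}) ` Q) \<longleftrightarrow>
    (\<forall>q\<in>Q. (a q + b q) mod k \<noteq> 0) \<and> inj_on (\<lambda>q. (a q + b q) mod k) Q"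
proof -
  have "inj_on (\<lambda>B. \<Sum>B mod k) ((\<lambda>q. {a q, b q}) ` Q) \<longleftrightarrow>
      inj_on ((\<lambda>B. \<Sum>B mod k) \<circ> (\<lambda>q. {a q, b q})) Q"
    using assms(1) comp_inj_on_iff by blast
  also have "\<dots> \<longleftrightarrow> inj_on (\<lambda>q. (a q + b q) mod k) Q"
    using assms(2) by (intro inj_on_cong) simp
  finally show ?thesis using assms(2) by (simp add: strong_def)
qed

section \<open>The symmetric set \<open>U\<close> built from an ordering of \<open>T\<close>, and
  skewness\<close>

definition sym_pairs :: "int \<Rightarrow> (int \<times> int) set \<Rightarrow> (int \<times> int) set" where
  "sym_pairs m Q = Q \<union> neg_pairs m Q \<union> {(0, 0)}"

text \<open>The sign condition \<open>half\<close> makes \<open>fst\<close> surjective onto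
  \<open>m\<close> residues, while the set has at most \<open>2 * card Q + 1 = m\<close> elements;
  hence \<open>fst\<close> is injective. For \<open>snd\<close>, a nonzero \<open>z\<close> that is
  not a second entry of \<open>Q\<close> is a first entry; then \<open>- z\<close> cannot be a first
  entry, so it is a second entry, and negating its pair gives \<open>z\<close>.\<close>

lemma sym_pairs_coordinates:
  assumes "m > 0" and T: "two_partition m T" and ord: "ordering_of T Q"
    and half: "(\<Union>(r, t)\<in>Q. {r mod m, (- r) mod m}) = Zstar m"
  shows "finite (sym_pairs m Q)"
    and "card (sym_pairs m Q) = nat m"
    and "fst ` sym_pairs m Q = {0..<m}"
    and "snd ` sym_pairs m Q = {0..<m}"
proof -
  let ?U = "sym_pairs m Q"
  have fin: "finite Q" and cover: "fst ` Q \<union> snd ` Q = Zstar m"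
    and card: "card (Zstar m) = 2 * card Q"
    using ordering_finite[OF T ord] ordering_cover[OF T ord] ordering_card[OF T ord] .
  have inZ: "r \<in> Zstar m" "t \<in> Zstar m" if "(r, t) \<in> Q" for r t
    using imageI[OF that, of fst] imageI[OF that, of snd] cover by auto
  have red: "z mod m = z" if "z \<in> Zstar m" for z
    using that by (simp add: Zstar_def)
  have int0: "{0..<m} = insert 0 (Zstar m)"
    using assms(1) by (auto simp: Zstar_def)
  show finU: "finite ?U" using fin by (simp add: sym_pairs_def neg_pairs_def)
  have "fst ` Q = (\<lambda>(r, t). r mod m) ` Q"
    using inZ(1) red by (intro image_cong) auto
  moreover have "fst ` neg_pairs m Q = (\<lambda>(r, t). (- r) mod m) ` Q"
    by (simp add: neg_pairs_def image_image case_prod_unfold)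
  moreover have "(\<Union>(r, t)\<in>Q. {r mod m, (- r) mod m}) =
      (\<lambda>(r, t). r mod m) ` Q \<union> (\<lambda>(r, t). (- r) mod m) ` Q"
    by auto
  ultimately have "fst ` ?U = insert 0 (\<Union>(r, t)\<in>Q. {r mod m, (- r) mod m})"
    unfolding sym_pairs_def image_Un by simp
  then show fstU: "fst ` ?U = {0..<m}" by (simp add: half int0)
  have neg_card: "card (neg_pairs m Q) \<le> card Q"
    unfolding neg_pairs_def using fin by (rule card_image_le)
  have m: "nat m = 2 * card Q + 1" using card card_Zstar[OF assms(1)] assms(1) by linarith
  have lower: "nat m \<le> card ?U"
    using card_image_le[OF finU, of fst] by (simp add: fstU)
  have upper: "card ?U \<le> card (Q \<union> neg_pairs m Q) + 1"
    unfolding sym_pairs_def using card_Un_le[of "Q \<union> neg_pairs m Q" "{(0, 0)}"] by simp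
  \<comment> \<open>An overlap would push the size of \<open>sym_pairs m Q\<close> below the lower
    bound \<open>m\<close>.\<close>
  have disj: "Q \<inter> neg_pairs m Q = {}"
  proof -
    have "finite (neg_pairs m Q)" using fin by (simp add: neg_pairs_def)
    then have "card (Q \<inter> neg_pairs m Q) = 0"
      using card_Un_Int[OF fin, of "neg_pairs m Q"] neg_card lower upper m by linarith
    then show ?thesis using fin by simp
  qed
  show cardU: "card ?U = nat m"
    using lower upper neg_card card_Un_le[of Q "neg_pairs m Q"] m by linarith
  have inj: "inj_on fst ?U"
    using finU by (rule eq_card_imp_inj_on) (simp add: fstU cardU)
  have neg: "((- r) mod m, (- t) mod m) \<in> neg_pairs m Q" if "(r, t) \<in> Q" for r t
    using that by (force simp: neg_pairs_def)
  have "z \<in> snd ` ?U" if z: "z \<in> Zstar m" for z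
  proof (cases "z \<in> snd ` Q")
    case True
    then show ?thesis by (auto simp: sym_pairs_def)
  next
    case False
    then obtain t where t: "(z, t) \<in> Q" using z cover by force
    have "(- z) mod m \<in> fst ` Q \<union> snd ` Q"
      using uminus_mod_Zstar[OF z] cover by simp
    moreover have "(- z) mod m \<notin> fst ` Q"
    proof
      assume "(- z) mod m \<in> fst ` Q"
      then obtain t' where t': "((- z) mod m, t') \<in> Q" by auto
      have "(z, (- t') mod m) \<in> neg_pairs m Q"
        using neg[OF t'] uminus_uminus_mod_Zstar[OF z] by simp
      \<comment> \<open>Injectivity of \<open>fst\<close> identifies the two pairs, so
        \<open>(z, t)\<close> would lie both in \<open>Q\<close> and in
        \<open>neg_pairs m Q\<close>.\<close>
      moreover from this t have "(z, t) = (z, (- t') mod m)"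
        by (intro inj_onD[OF inj]) (auto simp: sym_pairs_def)
      ultimately show False using t disj by auto
    qed
    ultimately obtain r where "(r, (- z) mod m) \<in> Q" by auto
    from neg[OF this] show ?thesis
      using uminus_uminus_mod_Zstar[OF z] by (force simp: sym_pairs_def)
  qed
  moreover have "snd ` ?U \<subseteq> insert 0 (Zstar m)"
    using inZ(2) uminus_mod_Zstar by (auto simp: sym_pairs_def neg_pairs_def)
  moreover have "0 \<in> snd ` ?U" by (force simp: sym_pairs_def)
  ultimately show "snd ` ?U = {0..<m}" unfolding int0 by auto
qed

lemma zero_notin_ordering:
  assumes "two_partition k P" and "ordering_of P Q"
  shows "(0, 0) \<notin> Q"
  using ordering_cover[OF assms] by (force simp: Zstar_def)

text \<open>Negating a pair negates its sum, so the symmetric set produces both signs of every sum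
  of \<open>T\<close>. This turns skewness into a statement about the image of one map.\<close>

lemma sums_sym_pairs:
  assumes "two_partition m T" and "ordering_of T Q" and "m > 0"
  shows "(\<lambda>(r, t). (r + t) mod m) ` sym_pairs m Q =
    insert 0 (\<Union>B\<in>T. {\<Sum>B mod m, (- \<Sum>B) mod m})"
proof -
  have card: "card (Zstar m) = 2 * card Q"
    using ordering_card[OF assms(1,2)] .
  have ne: "\<And>q. q \<in> Q \<Longrightarrow> fst q \<noteq> snd q"
    using pairs_two_partition(3)[OF ordering_finite ordering_cover card] assms by blast
  have "(\<Union>B\<in>T. {\<Sum>B mod m, (- \<Sum>B) mod m}) =
      (\<Union>(r, t)\<in>Q. {(r + t) mod m, (- (r + t)) mod m})"
    unfolding ordering_image[OF assms(2), symmetric] using ne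
    by (auto simp: case_prod_unfold)
  moreover have "((- r) mod m + (- t) mod m) mod m = (- (r + t)) mod m" for r t
    by (simp add: mod_add_eq)
  ultimately show ?thesis
    by (auto simp: sym_pairs_def neg_pairs_def image_Un image_image case_prod_unfold)
qed

text \<open>The set has \<open>m\<close> elements, so its sum map is injective exactly when it
  reaches all \<open>m\<close> residues. The pair \<open>(0, 0)\<close> takes the value 0; in the
  converse direction injectivity keeps every other pair away from 0, so the sums of \<open>T\<close>
  and their negatives fill exactly \<open>Zstar m\<close>.\<close>

lemma skew_iff_inj_on:
  assumes "two_partition m T" and "ordering_of T Q" and "m > 0"
    and fin: "finite (sym_pairs m Q)" and card: "card (sym_pairs m Q) = nat m"
  shows "skew m T \<longleftrightarrow> inj_on (\<lambda>(r, t). (r + t) mod m) (sym_pairs m Q)"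
    (is "_ \<longleftrightarrow> inj_on ?\<rho> ?U")
proof
  have int0: "{0..<m} = insert 0 (Zstar m)"
    using assms(3) by (auto simp: Zstar_def)
  note sums = sums_sym_pairs[OF assms(1-3)]
  {
    assume "skew m T"
    then have "?\<rho> ` ?U = {0..<m}" unfolding sums int0 skew_def by simp
    then show "inj_on ?\<rho> ?U" using fin card by (intro eq_card_imp_inj_on) auto
  next
    assume inj: "inj_on ?\<rho> ?U"
    have "?\<rho> ` ?U \<subseteq> {0..<m}" using assms(3) by auto
    moreover have "card (?\<rho> ` ?U) = card {0..<m}" using inj card by (simp add: card_image)
    ultimately have img: "?\<rho> ` ?U = {0..<m}" by (simp add: card_subset_eq)
    let ?X = "\<Union>B\<in>T. {\<Sum>B mod m, (- \<Sum>B) mod m}"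
    \<comment> \<open>A zero sum would collide with that of \<open>(0, 0)\<close>.\<close>
    have ne0: "(r + t) mod m \<noteq> 0" if "(r, t) \<in> Q" for r t
      using inj_onD[OF inj, of "(r, t)" "(0, 0)"] that zero_notin_ordering[OF assms(1,2)]
      by (auto simp: sym_pairs_def)
    have sum_ne0: "\<Sum>B mod m \<noteq> 0" if "B \<in> T" for B
    proof -
      obtain q where q: "q \<in> Q" "B = {fst q, snd q}"
        using \<open>B \<in> T\<close> ordering_image[OF assms(2)] by auto
      moreover have "fst q \<noteq> snd q"
        using pairs_two_partition(3)[OF ordering_finite ordering_cover ordering_card] assms(1,2) q
        by blast
      ultimately show ?thesis using ne0[of "fst q" "snd q"] by simp
    qed
    have "(- \<Sum>B) mod m \<noteq> 0" if "B \<in> T" for B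
      using sum_ne0[OF that] by (simp add: mod_eq_0_iff_dvd)
    then have "0 \<notin> ?X" using sum_ne0 by force
    then show "skew m T"
      using img unfolding sums int0 skew_def by (auto simp: Zstar_def)
  }
qed

section \<open>The product: index set, covering and sums\<close>

definition product_index ::
    "int \<Rightarrow> (int \<times> int) set \<Rightarrow> (int \<times> int) set \<Rightarrow> ((int \<times> int) \<times> (int \<times> int)) set" where
  "product_index m S' T' = sym_pairs m T' \<times> S' \<union> T' \<times> {(0, 0)}"

text \<open>Giving the pairs of type (ii) the residue part \<open>(0, 0)\<close> lets both types
  share a single formula.\<close>

lemma product_pairs_eq_image:
  "product_pairs n m S' T' =
    (\<lambda>((r, t), (x, y)). {(n * r + x) mod (n * m), (n * t + y) mod (n * m)}) `
      product_index m S' T'"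
  unfolding product_pairs_def product_index_def image_Un sym_pairs_def[symmetric]
  by (intro arg_cong2[where f = "(\<union>)"]; force)

lemma mult_add_in_interval:
  fixes n r x m :: int
  assumes "0 \<le> r" "r < m" "0 \<le> x" "x < n"
  shows "0 \<le> n * r + x" "n * r + x < n * m"
proof -
  show "0 \<le> n * r + x" using assms by simp
  have "n * (r + 1) \<le> n * m" using assms by (intro mult_left_mono) auto
  then show "n * r + x < n * m" using assms by (simp add: algebra_simps)
qed

text \<open>For covering, divide by \<open>n\<close> with remainder. Remainder 0 is met by type
  (ii), since \<open>T'\<close> covers the nonzero quotients; any other remainder occurs in
  \<open>S'\<close>, and some pair of \<open>sym_pairs m T'\<close> has the wanted quotient in the
  matching coordinate.\<close>

lemma product_index_cover:
  fixes n m :: int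
  assumes n: "n > 0"
    and S: "fst ` S' \<union> snd ` S' = Zstar n"
    and T: "fst ` T' \<union> snd ` T' = Zstar m"
    and U: "fst ` sym_pairs m T' = {0..<m}" "snd ` sym_pairs m T' = {0..<m}"
  shows "(\<lambda>((r, t), (x, y)). (n * r + x) mod (n * m)) ` product_index m S' T' \<union>
    (\<lambda>((r, t), (x, y)). (n * t + y) mod (n * m)) ` product_index m S' T' = Zstar (n * m)"
    (is "?a ` ?I \<union> ?b ` ?I = _")
proof
  have S': "x \<in> Zstar n" "y \<in> Zstar n" if "(x, y) \<in> S'" for x y
    using imageI[OF that, of fst] imageI[OF that, of snd] S by auto
  have T': "r \<in> Zstar m" "t \<in> Zstar m" if "(r, t) \<in> T'" for r t
    using imageI[OF that, of fst] imageI[OF that, of snd] T by auto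
  have U': "r \<in> {0..<m}" "t \<in> {0..<m}" if "(r, t) \<in> sym_pairs m T'" for r t
    using imageI[OF that, of fst] imageI[OF that, of snd] by (simp_all only: U fst_conv snd_conv)
  have i: "(n * r + x) mod (n * m) \<in> Zstar (n * m)" if "r \<in> {0..<m}" "x \<in> Zstar n" for r x
  proof -
    have "0 \<le> n * r" "0 < x" using n that by (simp_all add: Zstar_def)
    then have "n * r + x \<noteq> 0" by linarith
    then show ?thesis
      using that mult_add_in_interval[of r m x n] by (auto simp: Zstar_def)
  qed
  have ii: "(n * r) mod (n * m) \<in> Zstar (n * m)" if "r \<in> Zstar m" for r
    using that n by (simp add: Zstar_def)
  show "?a ` ?I \<union> ?b ` ?I \<subseteq> Zstar (n * m)"
  proof (intro Un_least image_subsetI)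
    fix p assume "p \<in> ?I"
    then obtain r t x y where p: "p = ((r, t), (x, y))" and
      "(r, t) \<in> sym_pairs m T' \<and> (x, y) \<in> S' \<or> (r, t) \<in> T' \<and> x = 0 \<and> y = 0"
      unfolding product_index_def by auto
    then show "?a p \<in> Zstar (n * m)" "?b p \<in> Zstar (n * m)"
      using i[of r x] i[of t y] ii[of r] ii[of t] S'[of x y] T'[of r t] U'[of r t] by auto
  qed
  show "Zstar (n * m) \<subseteq> ?a ` ?I \<union> ?b ` ?I"
  proof
    fix z assume z: "z \<in> Zstar (n * m)"
    define c d where "c = z div n" and "d = z mod n"
    have zcd: "(n * c + d) mod (n * m) = z"
      using z by (simp add: Zstar_def c_def d_def)
    have "c < m"
    proof (rule ccontr)
      assume "\<not> c < m"
      then have "n * m \<le> n * c" using n by simp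
      moreover have "n * c + z mod n = z" "0 \<le> z mod n" using n by (simp_all add: c_def)
      moreover have "z < n * m" using z by (simp add: Zstar_def)
      ultimately show False by linarith
    qed
    then have c: "c \<in> {0..<m}"
      using z n by (simp add: Zstar_def c_def pos_imp_zdiv_nonneg_iff)
    show "z \<in> ?a ` ?I \<union> ?b ` ?I"
    proof (cases "d = 0")
      case True
      then have "c \<in> Zstar m" using c zcd z by (auto simp: Zstar_def)
      then have "c \<in> fst ` T' \<union> snd ` T'" using T by simp
      then consider t where "(c, t) \<in> T'" | r where "(r, c) \<in> T'" by auto
      then show ?thesis
      proof cases
        case 1
        then have "((c, t), (0, 0)) \<in> ?I" by (simp add: product_index_def)
        then have "?a ((c, t), (0, 0)) \<in> ?a ` ?I" by (rule imageI)
        then show ?thesis using zcd True by simp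
      next
        case 2
        then have "((r, c), (0, 0)) \<in> ?I" by (simp add: product_index_def)
        then have "?b ((r, c), (0, 0)) \<in> ?b ` ?I" by (rule imageI)
        then show ?thesis using zcd True by simp
      qed
    next
      case False
      then have "d \<in> fst ` S' \<union> snd ` S'" using n S by (simp add: d_def Zstar_def)
      then consider y where "(d, y) \<in> S'" | x where "(x, d) \<in> S'" by auto
      then show ?thesis
      proof cases
        case 1
        obtain t where "(c, t) \<in> sym_pairs m T'" using c unfolding U(1)[symmetric] by auto
        then have "((c, t), (d, y)) \<in> ?I" using 1 by (simp add: product_index_def)
        then have "?a ((c, t), (d, y)) \<in> ?a ` ?I" by (rule imageI)
        then show ?thesis using zcd by simp
      next
        case 2
        obtain r where "(r, c) \<in> sym_pairs m T'" using c unfolding U(2)[symmetric] by auto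
        then have "((r, c), (x, d)) \<in> ?I" using 2 by (simp add: product_index_def)
        then have "?b ((r, c), (x, d)) \<in> ?b ` ?I" by (rule imageI)
        then show ?thesis using zcd by simp
      qed
    qed
  qed
qed

text \<open>The arithmetic core, with \<open>U\<close>, \<open>R\<close> and \<open>V\<close>
  standing for \<open>sym_pairs m T'\<close>, \<open>S'\<close> and \<open>T'\<close>. Here
  \<open>\<sigma>\<close> is the sum of the pair with a given index.\<close>

lemma product_sums_iff:
  fixes n m :: int
  assumes n: "n > 0" and m: "m > 0"
    and card: "card U = nat m"
    and zero: "(0, 0) \<in> U" and V: "V \<subseteq> U - {(0, 0)}" and "R \<noteq> {}"
  defines "\<sigma> \<equiv> \<lambda>((r, t), (x, y)). (n * (r + t) + (x + y)) mod (n * m)"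
  shows "(\<forall>i \<in> U \<times> R \<union> V \<times> {(0, 0)}. \<sigma> i \<noteq> 0) \<and> inj_on \<sigma> (U \<times> R \<union> V \<times> {(0, 0)}) \<longleftrightarrow>
    (\<forall>(x, y)\<in>R. (x + y) mod n \<noteq> 0) \<and> inj_on (\<lambda>(x, y). (x + y) mod n) R \<and>
    inj_on (\<lambda>(r, t). (r + t) mod m) U"
    (is "?nz \<and> ?inj \<longleftrightarrow> ?nzR \<and> ?injR \<and> ?injU")
proof
  assume asm: "?nz \<and> ?inj"
  then have nz: "\<And>u s. u \<in> U \<Longrightarrow> s \<in> R \<Longrightarrow> \<sigma> (u, s) \<noteq> 0"
    and inj: "\<And>u s v s'. u \<in> U \<Longrightarrow> s \<in> R \<Longrightarrow> v \<in> U \<Longrightarrow> s' \<in> R \<Longrightarrow>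
      \<sigma> (u, s) = \<sigma> (v, s') \<Longrightarrow> u = v \<and> s = s'"
    by (auto simp: inj_on_def)
  obtain s where s: "s \<in> R" using assms(6) by blast
  have injU: ?injU
  proof (rule inj_onI)
    fix u v assume uv: "u \<in> U" "v \<in> U"
      and "(case u of (r, t) \<Rightarrow> (r + t) mod m) = (case v of (r, t) \<Rightarrow> (r + t) mod m)"
    then have "\<sigma> (u, s) = \<sigma> (v, s)"
      using n by (simp add: \<sigma>_def case_prod_unfold mod_mult_left_eq_iff)
    then show "u = v" using inj uv s by blast
  qed
  have "(\<lambda>(r, t). (r + t) mod m) ` U \<subseteq> {0..<m}" using m by auto
  moreover have "card ((\<lambda>(r, t). (r + t) mod m) ` U) = card {0..<m}"
    using injU card by (simp add: card_image)
  ultimately have "(\<lambda>(r, t). (r + t) mod m) ` U = {0..<m}" by (simp add: card_subset_eq)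
  then have img: "k mod m \<in> (\<lambda>(r, t). (r + t) mod m) ` U" for k using m by simp
  \<comment> \<open>Since \<open>U\<close> has \<open>m\<close> elements, injectivity gives every
    quotient. Thus each single pair of \<open>R\<close> already yields all of its residue class
    modulo \<open>n\<close>.\<close>
  have onto: "\<exists>r t. (r, t) \<in> U \<and> (r + t) mod m = k mod m" for k
    using img[of k] by (metis (no_types, lifting) imageE prod.case prod.exhaust)
  have ?nzR
  proof clarify
    fix x y assume R: "(x, y) \<in> R" and "n dvd x + y"
    then obtain k where k: "x + y = n * k" by (auto simp: dvd_def)
    \<comment> \<open>The quotient \<open>- k\<close> is chosen to cancel \<open>n * k\<close> and
      produce a forbidden sum 0.\<close>
    obtain r t where rt: "(r, t) \<in> U" "(r + t) mod m = (- k) mod m" using onto by blast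
    have "\<sigma> ((r, t), (x, y)) = (n * (- k) + n * k) mod (n * m)"
      using n rt(2) by (simp only: \<sigma>_def prod.case k mod_mult_left_eq_iff)
    then show False using nz[OF rt(1) R] by simp
  qed
  moreover have ?injR
  proof (rule inj_onI, clarify)
    fix x y x' y' assume R: "(x, y) \<in> R" "(x', y') \<in> R" and "(x + y) mod n = (x' + y') mod n"
    then obtain k where k: "x + y = n * k + (x' + y')"
      by (metis mod_eq_dvd_iff dvd_def diff_eq_eq)
    \<comment> \<open>This choice absorbs the difference \<open>n * k\<close>, giving a collision
      with the index \<open>((0, 0), (x, y))\<close>.\<close>
    obtain r t where rt: "(r, t) \<in> U" "(r + t) mod m = k mod m" using onto by blast
    have "\<sigma> ((r, t), (x', y')) = (n * k + (x' + y')) mod (n * m)"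
      using n rt(2) by (simp only: \<sigma>_def prod.case mod_mult_left_eq_iff)
    also have "\<dots> = \<sigma> ((0, 0), (x, y))" by (simp add: \<sigma>_def k)
    finally show "x = x' \<and> y = y'" using inj[OF rt(1) R(2) zero R(1)] by simp
  qed
  ultimately show "?nzR \<and> ?injR \<and> ?injU" using injU by blast
next
  assume asm: "?nzR \<and> ?injR \<and> ?injU"
  then have R: ?nzR ?injR and U: ?injU by simp_all
  have nzR: "(x + y) mod n \<noteq> 0" if "(x, y) \<in> R" for x y
    using bspec[OF R(1) that] by simp
  have injR: "x = x' \<and> y = y'"
    if "(x, y) \<in> R" "(x', y') \<in> R" "(x + y) mod n = (x' + y') mod n" for x y x' y'
    using inj_onD[OF R(2) _ that(1,2)] that(3) by simp
  have injU: "r = r' \<and> t = t'"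
    if "(r, t) \<in> U" "(r', t') \<in> U" "(r + t) mod m = (r' + t') mod m" for r t r' t'
    using inj_onD[OF U _ that(1,2)] that(3) by simp
  have res: "(x + y) mod n = (x' + y') mod n"
    if "\<sigma> ((r, t), (x, y)) = \<sigma> ((r', t'), (x', y'))" for r t x y r' t' x' y'
    using that unfolding \<sigma>_def prod.case by (rule mod_mult_left_imp_mod_eq)
  have fibre: "(r + t) mod m = (r' + t') mod m"
    if "\<sigma> ((r, t), (x, y)) = \<sigma> ((r', t'), (x, y))" for r t x y r' t'
    using that n by (simp add: \<sigma>_def mod_mult_left_eq_iff)
  \<comment> \<open>Lets a zero sum be treated as a collision with the all-zero index.\<close>
  have sig0: "\<sigma> ((0, 0), (0, 0)) = 0" by (simp add: \<sigma>_def)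
  have "\<sigma> ((r, t), (x, y)) \<noteq> 0" if "((r, t), (x, y)) \<in> U \<times> R \<union> V \<times> {(0, 0)}" for r t x y
  proof
    assume "\<sigma> ((r, t), (x, y)) = 0"
    then have eq: "\<sigma> ((r, t), (x, y)) = \<sigma> ((0, 0), (0, 0))" by (simp add: sig0)
    from res[OF this] nzR[of x y] have "(x, y) \<notin> R" by auto
    with that have V0: "(r, t) \<in> V" "x = 0" "y = 0" by auto
    with eq have "(r + t) mod m = (0 + 0) mod m" by (intro fibre[of r t 0 0]) simp
    with V V0(1) zero have "r = 0 \<and> t = 0" by (intro injU) auto
    with V V0(1) show False by auto
  qed
  moreover have ?inj
  proof (rule inj_onI, clarify, goal_cases)
    case (1 r t x y r' t' x' y')
    note eq = res[OF 1(3)]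
    \<comment> \<open>Modulo \<open>n\<close>, sums of type (ii) vanish and those of type (i) do
      not, so colliding indices have the same type.\<close>
    have "(x, y) \<in> R \<longleftrightarrow> (x', y') \<in> R"
      using 1(1,2) eq nzR[of x y] nzR[of x' y'] by auto
    then have xy: "x = x' \<and> y = y'"
      using 1(1,2) eq injR[of x y x' y'] by auto
    then have "(r + t) mod m = (r' + t') mod m"
      using 1(3) fibre[of r t x y r' t'] by simp
    then have "r = r' \<and> t = t'"
      using 1(1,2) V by (intro injU) auto
    with xy show ?case by simp
  qed
  ultimately show "?nz \<and> ?inj" by auto
qed

theorem theorem3p6:
  fixes n m :: int and S T W :: "int set set"
  assumes "odd n" and "n \<ge> 3" and "odd m" and "m \<ge> 3"
    and "two_partition n S" and "two_partition m T"
    and "is_product n m S T W"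
  shows "(two_partition (m * n) W \<and> strong (m * n) W) \<longleftrightarrow> (strong n S \<and> skew m T)"
proof -
  obtain S' T' where S': "ordering_of S S'" and T': "ordering_of T T'"
    and half: "(\<Union>(r, t)\<in>T'. {r mod m, (- r) mod m}) = Zstar m"
    and W: "W = product_pairs n m S' T'"
    using assms(7) by (auto simp: is_product_def)
  have n: "n > 0" and m: "m > 0" using assms by auto
  define I where "I = product_index m S' T'"
  define a b :: "(int \<times> int) \<times> (int \<times> int) \<Rightarrow> int"
    where "a = (\<lambda>((r, t), (x, y)). (n * r + x) mod (n * m))"
      and "b = (\<lambda>((r, t), (x, y)). (n * t + y) mod (n * m))"
  note Sfacts = ordering_finite[OF assms(5) S'] ordering_cover[OF assms(5) S']
    ordering_card[OF assms(5) S']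
  note Tfacts = ordering_finite[OF assms(6) T'] ordering_cover[OF assms(6) T']
    ordering_card[OF assms(6) T']
  note U = sym_pairs_coordinates[OF m assms(6) T' half]
  have finI: "finite I"
    using Sfacts(1) Tfacts(1) U(1) by (simp add: I_def product_index_def)
  have cover: "a ` I \<union> b ` I = Zstar (n * m)"
    unfolding I_def a_def b_def
    by (rule product_index_cover[OF n Sfacts(2) Tfacts(2) U(3,4)])
  \<comment> \<open>The count behind \<open>cardI\<close>: twice this number is
    \<open>m * (n - 1) + (m - 1) = n * m - 1\<close>.\<close>
  have "card I = card (sym_pairs m T') * card S' + card T'"
    unfolding I_def product_index_def
    using zero_notin_ordering[OF assms(5) S'] Sfacts(1) Tfacts(1) U(1)
    by (subst card_Un_disjoint) (auto simp: card_cartesian_product)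
  then have "2 * int (card I) = m * (2 * int (card S')) + 2 * int (card T')"
    using m by (simp add: U(2))
  also have "2 * int (card S') = n - 1"
    using Sfacts(3) card_Zstar[OF n] by linarith
  also have "2 * int (card T') = m - 1"
    using Tfacts(3) card_Zstar[OF m] by linarith
  also have "m * (n - 1) + (m - 1) = int (card (Zstar (n * m)))"
    using n m by (simp add: card_Zstar algebra_simps)
  finally have cardI: "card (Zstar (n * m)) = 2 * card I" by linarith
  have W_image: "W = (\<lambda>i. {a i, b i}) ` I"
    unfolding W product_pairs_eq_image I_def a_def b_def
    by (intro image_cong) auto
  note part = pairs_two_partition[OF finI cover cardI]
  have sums: "(a i + b i) mod (n * m) =
      (\<lambda>((r, t), (x, y)). (n * (r + t) + (x + y)) mod (n * m)) i" for i
    by (cases i) (simp only: a_def b_def prod.case case_prod_unfold mod_add_eq fst_conv snd_conv,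
      simp add: algebra_simps)
  have strong_W: "strong (n * m) W \<longleftrightarrow>
      (\<forall>i\<in>I. (a i + b i) mod (n * m) \<noteq> 0) \<and> inj_on (\<lambda>i. (a i + b i) mod (n * m)) I"
    unfolding W_image using part(2,3) by (rule strong_pairs_iff)
  \<comment> \<open>Here \<open>n \<ge> 3\<close> enters: skewness of \<open>T\<close> is recovered
    from the pairs over one pair of \<open>S\<close>, which must exist.\<close>
  have ne: "S' \<noteq> {}"
    using Sfacts(3) card_Zstar[OF n] assms(2) by auto
  have sub: "T' \<subseteq> sym_pairs m T' - {(0, 0)}"
    using zero_notin_ordering[OF assms(6) T'] by (auto simp: sym_pairs_def)
  have zero: "(0, 0) \<in> sym_pairs m T'" by (simp add: sym_pairs_def)
  have "strong (n * m) W \<longleftrightarrow>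
      (\<forall>(x, y)\<in>S'. (x + y) mod n \<noteq> 0) \<and> inj_on (\<lambda>(x, y). (x + y) mod n) S' \<and>
      inj_on (\<lambda>(r, t). (r + t) mod m) (sym_pairs m T')"
    unfolding strong_W sums
    unfolding I_def product_index_def
    by (rule product_sums_iff[OF n m U(2) zero sub ne])
  also have "inj_on (\<lambda>(r, t). (r + t) mod m) (sym_pairs m T') \<longleftrightarrow> skew m T"
    using skew_iff_inj_on[OF assms(6) T' m U(1,2)] by simp
  finally have "strong (n * m) W \<longleftrightarrow> strong n S \<and> skew m T"
    using strong_pairs_iff[OF pairs_two_partition(2,3)[OF Sfacts], of n]
    by (simp add: ordering_image[OF S'] case_prod_unfold)
  moreover have "two_partition (n * m) W" using part(1) by (simp add: W_image)
  ultimately show ?thesis by (simp add: mult.commute)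
qed

end
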